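(* Let $H$ be a commutative ring with identity, let $S\subseteq H$ be a finite multiplicatively closed subset, and suppose $S\cap M=\varnothing$ for every maximal ideal $M$ of $H$. Then the following statements are equivalent: (a) $H$ is an $S$-$uz$-ring. (b) Every prime ideal $A$ of $H$ with $A\cap S=\varnothing$ is an $S$-$r$-ideal. (c) Every maximal ideal of $H$ is an $S$-$r$-ideal.
   Context: For $w\in H$, $\mathrm{Ann}(w)=\{y\in H: yw=0\}$; $w$ is a zero divisor if $\mathrm{Ann}(w)\neq 0$. A multiplicatively closed subset $S$ of $H$ is a subset containing $1$ and closed under products. An ideal $A$ of $H$ is an $S$-$r$-ideal if $A\cap S=\varnothing$ and there exists $s\in S$ such that for all $w,z\in H$, if $wz\in A$ and $\mathrm{Ann}(w)=0$, then $sz\in A$. An element $a\in H$ is an $S$-unit if $Ha\cap S\neq\varnothing$. $H$ is an $S$-$uz$-ring if each element of $H$ is either a zero divisor or an $S$-unit. *)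

theory Defs
  imports "HOL-Algebra.Algebra"
begin

text \<open>
  A multiplicatively closed subset \<open>S\<close> of a ring \<open>H\<close> is a submonoid of its multiplicative
  monoid, i.e. the library predicate \<open>submonoid S H\<close>; it may contain zero. The principal ideal
  \<open>Ha\<close> is the library's \<open>PIdl\<^bsub>H\<^esub> a\<close>.
\<close>

definition Ann :: "('a, 'm) ring_scheme \<Rightarrow> 'a \<Rightarrow> 'a set" where
  "Ann H w = {y \<in> carrier H. y \<otimes>\<^bsub>H\<^esub> w = \<zero>\<^bsub>H\<^esub>}"

text \<open>In a nontrivial ring, \<open>\<zero>\<close> itself is a zero divisor; in the zero ring nothing is.\<close>

definition zero_divisor :: "('a, 'm) ring_scheme \<Rightarrow> 'a \<Rightarrow> bool" where
  "zero_divisor H w \<longleftrightarrow> w \<in> carrier H \<and> Ann H w \<noteq> {\<zero>\<^bsub>H\<^esub>}"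

text \<open>The element \<open>s\<close> is chosen uniformly, before \<open>w\<close> and \<open>z\<close>.\<close>

definition S_r_ideal :: "('a, 'm) ring_scheme \<Rightarrow> 'a set \<Rightarrow> 'a set \<Rightarrow> bool" where
  "S_r_ideal H S A \<longleftrightarrow>
     ideal A H \<and> A \<inter> S = {} \<and>
     (\<exists>s\<in>S. \<forall>w\<in>carrier H. \<forall>z\<in>carrier H.
        w \<otimes>\<^bsub>H\<^esub> z \<in> A \<and> Ann H w = {\<zero>\<^bsub>H\<^esub>} \<longrightarrow> s \<otimes>\<^bsub>H\<^esub> z \<in> A)"

definition S_unit :: "('a, 'm) ring_scheme \<Rightarrow> 'a set \<Rightarrow> 'a \<Rightarrow> bool" where
  "S_unit H S a \<longleftrightarrow> a \<in> carrier H \<and> (PIdl\<^bsub>H\<^esub> a) \<inter> S \<noteq> {}"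

definition S_uz_ring :: "('a, 'm) ring_scheme \<Rightarrow> 'a set \<Rightarrow> bool" where
  "S_uz_ring H S \<longleftrightarrow> (\<forall>a\<in>carrier H. zero_divisor H a \<or> S_unit H S a)"

end

theory Submission
  imports Defs
begin

text \<open>
  Call an element regular if its annihilator is zero; being \<open>S\<close>-\<open>uz\<close> means that every regular
  element has a multiple in \<open>S\<close>. A prime ideal disjoint from \<open>S\<close> contains no element with a
  multiple in \<open>S\<close>, so in an \<open>S\<close>-\<open>uz\<close>-ring it contains no regular element, and primality then lets
  a regular factor \<open>w\<close> be cancelled from \<open>w \<otimes> z \<in> A\<close> outright, with \<open>s = \<one>\<close>
  (\<open>prime_disjoint_imp_S_r_ideal\<close>).

  Conversely, an \<open>S\<close>-\<open>r\<close>-ideal contains no regular element \<open>w\<close>: taking \<open>z = \<one>\<close> would force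
  \<open>s \<in> A \<inter> S\<close> (\<open>S_r_ideal_no_regular\<close>). If every maximal ideal is an \<open>S\<close>-\<open>r\<close>-ideal, a regular
  element therefore lies in no maximal ideal, so by Krull's theorem
  (\<open>proper_ideal_in_maximalideal\<close>) it is an honest unit, and \<open>\<one> \<in> S\<close> is one of its multiples.
  Maximal ideals being prime and, by assumption, disjoint from \<open>S\<close>, the three conditions form
  a cycle.
\<close>

text \<open>
  Krull's theorem, by Zorn's lemma: the union of a nonempty chain of proper ideals is an ideal,
  and it stays proper because an ideal is proper exactly when it omits \<open>\<one>\<close>.
\<close>
lemma (in ring) proper_ideal_in_maximalideal:
  assumes I: "ideal I R" and proper: "I \<noteq> carrier R"
  shows "\<exists>M. maximalideal M R \<and> I \<subseteq> M"
proof -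
  define F where "F = {J. ideal J R \<and> \<one> \<notin> J \<and> I \<subseteq> J}"
  have IF: "I \<in> F"
    using I proper ideal.one_imp_carrier[OF I] by (auto simp: F_def)
  have "\<exists>M\<in>F. \<forall>J\<in>F. M \<subseteq> J \<longrightarrow> J = M"
  proof (rule subset_Zorn_nonempty)
    show "F \<noteq> {}" using IF by blast
  next
    fix C assume ne: "C \<noteq> {}" and chain: "subset.chain F C"
    have "subset.chain {J. ideal J R} C"
      using chain by (auto simp: subset_chain_def F_def)
    then have "ideal (\<Union>C) R"
      using chain_Union_is_ideal[of C] ne by simp
    then show "\<Union>C \<in> F"
      using chain ne by (auto simp: subset_chain_def F_def)
  qed
  then obtain M where M: "M \<in> F" and max: "\<And>J. J \<in> F \<Longrightarrow> M \<subseteq> J \<Longrightarrow> J = M"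
    by blast
  have "maximalideal M R"
  proof (rule maximalidealI)
    show "ideal M R" "carrier R \<noteq> M"
      using M by (auto simp: F_def)
  next
    fix J assume J: "ideal J R" "M \<subseteq> J"
    show "J = M \<or> J = carrier R"
    proof (cases "\<one> \<in> J")
      case True
      then show ?thesis using ideal.one_imp_carrier[OF J(1)] by blast
    next
      case False
      then have "J \<in> F" using J M by (auto simp: F_def)
      then show ?thesis using max[OF _ J(2)] by blast
    qed
  qed
  then show ?thesis using M by (auto simp: F_def)
qed

lemma prime_disjoint_imp_S_r_ideal:
  assumes one: "\<one>\<^bsub>H\<^esub> \<in> S" and uz: "S_uz_ring H S"
    and A: "primeideal A H" and disj: "A \<inter> S = {}"
  shows "S_r_ideal H S A"
proof -
  interpret primeideal A H by (fact A)
  have "\<forall>w\<in>carrier H. \<forall>z\<in>carrier H.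
      w \<otimes>\<^bsub>H\<^esub> z \<in> A \<and> Ann H w = {\<zero>\<^bsub>H\<^esub>} \<longrightarrow> \<one>\<^bsub>H\<^esub> \<otimes>\<^bsub>H\<^esub> z \<in> A"
  proof (intro ballI impI; elim conjE)
    fix w z
    assume w: "w \<in> carrier H" and z: "z \<in> carrier H" and wz: "w \<otimes>\<^bsub>H\<^esub> z \<in> A"
      and reg: "Ann H w = {\<zero>\<^bsub>H\<^esub>}"
    have "(PIdl\<^bsub>H\<^esub> w) \<inter> S \<noteq> {}"
      using uz w reg by (auto simp: S_uz_ring_def zero_divisor_def S_unit_def)
    then have "w \<notin> A"
      using cgenideal_minimal[OF is_ideal] disj by blast
    then have "z \<in> A" using I_prime[OF w z wz] by blast
    then show "\<one>\<^bsub>H\<^esub> \<otimes>\<^bsub>H\<^esub> z \<in> A" using z by simp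
  qed
  then show ?thesis
    unfolding S_r_ideal_def using one disj is_ideal by blast
qed

lemma (in cring) S_r_ideal_no_regular:
  assumes "S_r_ideal R S A" and S: "S \<subseteq> carrier R"
    and w: "w \<in> A" and reg: "Ann R w = {\<zero>}"
  shows False
proof -
  obtain s where A: "ideal A R" and disj: "A \<inter> S = {}" and s: "s \<in> S"
    and r: "\<And>w z. w \<in> carrier R \<Longrightarrow> z \<in> carrier R \<Longrightarrow> w \<otimes> z \<in> A \<Longrightarrow> Ann R w = {\<zero>}
      \<Longrightarrow> s \<otimes> z \<in> A"
    using assms(1) unfolding S_r_ideal_def by blast
  have wc: "w \<in> carrier R" using ideal.Icarr[OF A w] .
  have "s \<otimes> \<one> \<in> A"
    using r[OF wc one_closed] w wc reg by simp
  moreover have "s \<otimes> \<one> = s"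
    using s S by (intro r_one) blast
  ultimately show False using s disj by auto
qed

lemma (in cring) maximal_S_r_imp_S_uz_ring:
  assumes one: "\<one> \<in> S" and S: "S \<subseteq> carrier R"
    and max: "\<And>M. maximalideal M R \<Longrightarrow> S_r_ideal R S M"
  shows "S_uz_ring R S"
  unfolding S_uz_ring_def
proof (intro ballI disjCI)
  fix a assume a: "a \<in> carrier R" and "\<not> S_unit R S a"
  then have "\<one> \<notin> PIdl\<^bsub>R\<^esub> a"
    using one by (auto simp: S_unit_def)
  then obtain M where M: "maximalideal M R" "PIdl\<^bsub>R\<^esub> a \<subseteq> M"
    using proper_ideal_in_maximalideal[OF cgenideal_ideal[OF a]] one_closed by metis
  then have "a \<in> M" using cgenideal_self[OF a] by blast
  then have "Ann R a \<noteq> {\<zero>}"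
    using S_r_ideal_no_regular[OF max[OF M(1)] S] by blast
  then show "zero_divisor R a" using a by (simp add: zero_divisor_def)
qed

theorem proposition2p14:
  fixes H :: "('a, 'm) ring_scheme" and S :: "'a set"
  assumes "cring H"
    and "submonoid S H"
    and "finite S"
    and "\<And>M. maximalideal M H \<Longrightarrow> S \<inter> M = {}"
  shows "(S_uz_ring H S \<longleftrightarrow> (\<forall>A. primeideal A H \<and> A \<inter> S = {} \<longrightarrow> S_r_ideal H S A))
    \<and> ((\<forall>A. primeideal A H \<and> A \<inter> S = {} \<longrightarrow> S_r_ideal H S A)
        \<longleftrightarrow> (\<forall>M. maximalideal M H \<longrightarrow> S_r_ideal H S M))"
proof -
  interpret cring H by (fact assms(1))
  have one: "\<one>\<^bsub>H\<^esub> \<in> S" and S: "S \<subseteq> carrier H"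
    using submonoid.one_closed[OF assms(2)] submonoid.subset[OF assms(2)] by auto
  have ab: "S_r_ideal H S A" if "S_uz_ring H S" "primeideal A H" "A \<inter> S = {}" for A
    using prime_disjoint_imp_S_r_ideal[OF one that] .
  have bc: "primeideal M H \<and> M \<inter> S = {}" if "maximalideal M H" for M
    using maximalideal_prime[OF that] assms(4)[OF that] by blast
  have ca: "S_uz_ring H S" if "\<And>M. maximalideal M H \<Longrightarrow> S_r_ideal H S M"
    using maximal_S_r_imp_S_uz_ring[OF one S that] .
  show ?thesis
  proof (intro conjI iffI allI impI; (elim conjE)?)
    show "S_r_ideal H S A" if "S_uz_ring H S" "primeideal A H" "A \<inter> S = {}" for A
      by (rule ab[OF that])
    show "S_uz_ring H S"
      if "\<forall>A. primeideal A H \<and> A \<inter> S = {} \<longrightarrow> S_r_ideal H S A"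
      using that bc by (intro ca) simp
    show "S_r_ideal H S M"
      if "\<forall>A. primeideal A H \<and> A \<inter> S = {} \<longrightarrow> S_r_ideal H S A" "maximalideal M H" for M
      using that bc by simp
    show "S_r_ideal H S A"
      if "\<forall>M. maximalideal M H \<longrightarrow> S_r_ideal H S M" "primeideal A H" "A \<inter> S = {}" for A
      using ab[OF ca] that by simp
  qed
qed

end
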